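(* Let $k\ge 2$ and $d\ge 1$ be integers. The Hamming graph $H(d,k)$ admits a neighborhood-balanced $k$-coloring if and only if $d\equiv 0\pmod k$.
   Context: A neighborhood-balanced $k$-coloring of a graph is a (not necessarily proper) vertex coloring with colors $1,\dots,k$ such that every vertex has the same number of neighbors of each of the $k$ colors. The Hamming graph $H(d,k)$ has vertex set $S^d$, where $S$ is a set with $|S|=k$, and two vertices are adjacent if and only if they differ in exactly one coordinate. *)

theory Defs
  imports "Graph_Theory.Pair_Digraph" "HOL-Library.FuncSet" "HOL-Number_Theory.Cong"
begin

text \<open>
  Finite simple graphs are the structures satisfying \<^locale>\<open>pair_graph\<close>: an edge joining u and v
  is represented by the two arcs (u, v) and (v, u).
\<close>

definition neighbors :: "'v pair_pre_digraph \<Rightarrow> 'v \<Rightarrow> 'v set" where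
  "neighbors G v = {w. v \<rightarrow>\<^bsub>with_proj G\<^esub> w}"

definition neighborhood_balanced_coloring ::
    "'v pair_pre_digraph \<Rightarrow> nat \<Rightarrow> ('v \<Rightarrow> nat) \<Rightarrow> bool" where
  "neighborhood_balanced_coloring G k c \<longleftrightarrow>
     c \<in> pverts G \<rightarrow> {1..k} \<and>
     (\<forall>v \<in> pverts G. \<forall>i \<in> {1..k}. \<forall>j \<in> {1..k}.
        card {w \<in> neighbors G v. c w = i} = card {w \<in> neighbors G v. c w = j})"

text \<open>
  A word in \<open>S\<^sup>d\<close> is a function from the coordinates \<open>{..<d}\<close> to \<open>S\<close>, made unique outside
  \<open>{..<d}\<close> by extensionality. The graph H(d,k) is \<open>hamming_graph d S\<close> for any \<open>S\<close> with k elements.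
\<close>

definition hamming_graph :: "nat \<Rightarrow> 'a set \<Rightarrow> (nat \<Rightarrow> 'a) pair_pre_digraph" where
  "hamming_graph d S =
     \<lparr> pverts = {..<d} \<rightarrow>\<^sub>E S,
       parcs = {(x, y). x \<in> {..<d} \<rightarrow>\<^sub>E S \<and> y \<in> {..<d} \<rightarrow>\<^sub>E S \<and>
                        card {i \<in> {..<d}. x i \<noteq> y i} = 1} \<rparr>"

lemma pair_graph_hamming_graph:
  assumes "finite S"
  shows "pair_graph (hamming_graph d S)"
proof -
  have fin: "finite ({..<d} \<rightarrow>\<^sub>E S)"
    using assms by (intro finite_PiE) simp_all
  have "parcs (hamming_graph d S) \<subseteq> ({..<d} \<rightarrow>\<^sub>E S) \<times> ({..<d} \<rightarrow>\<^sub>E S)"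
    unfolding hamming_graph_def by force
  then have fin_arcs: "finite (parcs (hamming_graph d S))"
    by (rule finite_subset) (intro finite_cartesian_product fin)
  have diff_sym: "card {i \<in> {..<d}. x i \<noteq> y i} = card {i \<in> {..<d}. y i \<noteq> x i}"
    for x y :: "nat \<Rightarrow> 'a"
    by (rule arg_cong[where f = card], rule Collect_cong) metis
  have sym: "sym (parcs (hamming_graph d S))"
  proof (rule symI)
    fix x y
    assume "(x, y) \<in> parcs (hamming_graph d S)"
    then show "(y, x) \<in> parcs (hamming_graph d S)"
      unfolding hamming_graph_def using diff_sym[of x y] by simp
  qed
  have arcsD: "fst e \<in> {..<d} \<rightarrow>\<^sub>E S" "snd e \<in> {..<d} \<rightarrow>\<^sub>E S" "fst e \<noteq> snd e"
    if "e \<in> parcs (hamming_graph d S)" for e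
    using that unfolding hamming_graph_def by (cases e; force)+
  show ?thesis
    by unfold_locales
      (use fin fin_arcs sym arcsD in \<open>simp_all add: symmetric_def\<close>,
       simp_all add: hamming_graph_def)
qed

end

theory Submission
  imports Defs
begin

text \<open>
  Every vertex of \<open>H(d,k)\<close> has \<open>d (k - 1)\<close> neighbors: choose a coordinate, then one of the
  \<open>k - 1\<close> other letters to put there. A balanced coloring splits them into \<open>k\<close> classes of equal
  size, so \<open>k\<close> divides \<open>d (k - 1)\<close>, and hence \<open>d\<close>, as \<open>k\<close> and \<open>k - 1\<close> are coprime.

  Conversely let \<open>d = m k\<close>. Identify the alphabet with the residues modulo \<open>k\<close> and color a word by
  the sum of its first \<open>n = m (k - 1)\<close> letters modulo \<open>k\<close>. Changing one of these letters gives every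
  color except the present one exactly once; changing one of the remaining \<open>d - n = m\<close> letters always
  leaves the color as it is. So every other color occurs \<open>n\<close> times among the neighbors, and the
  present one \<open>m (k - 1) = n\<close> times as well.
\<close>

text \<open>
  The parametrization of neighbors by a coordinate and a new letter turns counting neighbors
  into counting letters, one coordinate at a time.
\<close>

lemma bij_betw_hamming_neighbors:
  assumes x: "x \<in> {..<d} \<rightarrow>\<^sub>E S"
  shows "bij_betw (\<lambda>(i, s). x(i := s)) (SIGMA i:{..<d}. S - {x i})
           (neighbors (hamming_graph d S) x)"
proof -
  have "inj_on (\<lambda>(i, s). x(i := s)) (SIGMA i:{..<d}. S - {x i})"
  proof (rule inj_onI)
    fix p q
    assume p: "p \<in> (SIGMA i:{..<d}. S - {x i})"
      and eq: "(case p of (i, s) \<Rightarrow> x(i := s)) = (case q of (i, s) \<Rightarrow> x(i := s))"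
    obtain i s j t where pq: "p = (i, s)" "q = (j, t)"
      by (metis surj_pair)
    then have "s = (x(j := t)) i"
      using fun_cong[OF eq, of i] by simp
    moreover have "s \<noteq> x i"
      using p pq by simp
    ultimately show "p = q"
      using pq by (auto split: if_splits)
  qed
  moreover have "(\<lambda>(i, s). x(i := s)) ` (SIGMA i:{..<d}. S - {x i})
      = neighbors (hamming_graph d S) x"
  proof (intro equalityI subsetI)
    fix w assume "w \<in> (\<lambda>(i, s). x(i := s)) ` (SIGMA i:{..<d}. S - {x i})"
    then obtain i s where upd: "i < d" "s \<in> S" "s \<noteq> x i" "w = x(i := s)"
      by auto
    have "{j \<in> {..<d}. x j \<noteq> w j} = {i}"
      using upd by auto
    moreover have "w \<in> {..<d} \<rightarrow>\<^sub>E S"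
      using upd x by (auto simp: PiE_iff extensional_def)
    ultimately show "w \<in> neighbors (hamming_graph d S) x"
      using x by (simp add: neighbors_def hamming_graph_def)
  next
    fix w assume "w \<in> neighbors (hamming_graph d S) x"
    then have w: "w \<in> {..<d} \<rightarrow>\<^sub>E S" and "card {j \<in> {..<d}. x j \<noteq> w j} = 1"
      by (auto simp: neighbors_def hamming_graph_def)
    then obtain i where i: "{j \<in> {..<d}. x j \<noteq> w j} = {i}"
      by (auto simp: card_1_singleton_iff)
    have "i < d" "w i \<noteq> x i"
      using eqset_imp_iff[OF i, of i] by auto
    moreover have "w = x(i := w i)"
    proof
      fix j
      show "w j = (x(i := w i)) j"
      proof (cases "j < d")
        case True
        then show ?thesis
          using eqset_imp_iff[OF i, of j] by auto
      next
        case False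
        then show ?thesis
          using x w \<open>i < d\<close> by (auto simp: PiE_iff extensional_def)
      qed
    qed
    ultimately show "w \<in> (\<lambda>(i, s). x(i := s)) ` (SIGMA i:{..<d}. S - {x i})"
      using w by (intro image_eqI[where x = "(i, w i)"]) auto
  qed
  ultimately show ?thesis
    by (simp add: bij_betw_def)
qed

lemma card_hamming_neighbors_filter:
  assumes "finite S" and x: "x \<in> {..<d} \<rightarrow>\<^sub>E S"
  shows "card {w \<in> neighbors (hamming_graph d S) x. P w}
    = (\<Sum>i<d. card {s \<in> S - {x i}. P (x(i := s))})"
proof -
  let ?f = "\<lambda>(i, s). x(i := s)"
  let ?A = "SIGMA i:{..<d}. {s \<in> S - {x i}. P (x(i := s))}"
  have bij: "bij_betw ?f (SIGMA i:{..<d}. S - {x i}) (neighbors (hamming_graph d S) x)"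
    by (rule bij_betw_hamming_neighbors[OF x])
  have "{w \<in> neighbors (hamming_graph d S) x. P w} = ?f ` ?A"
    unfolding bij_betw_imp_surj_on[OF bij, symmetric] by force
  moreover have "inj_on ?f ?A"
    by (rule inj_on_subset[OF bij_betw_imp_inj_on[OF bij]]) auto
  ultimately have "card {w \<in> neighbors (hamming_graph d S) x. P w} = card ?A"
    by (simp add: card_image)
  also have "\<dots> = (\<Sum>i<d. card {s \<in> S - {x i}. P (x(i := s))})"
    using \<open>finite S\<close> by (intro card_SigmaI) auto
  finally show ?thesis .
qed

lemma card_hamming_neighbors:
  assumes "finite S" and x: "x \<in> {..<d} \<rightarrow>\<^sub>E S"
  shows "card (neighbors (hamming_graph d S) x) = d * (card S - 1)"
proof -
  have "{s \<in> S - {x i}. True} = S - {x i}" for i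
    by blast
  then have "card (neighbors (hamming_graph d S) x) = (\<Sum>i<d. card (S - {x i}))"
    using card_hamming_neighbors_filter[OF assms, where P = "\<lambda>_. True"]
    by (simp only: simp_thms Collect_mem_eq)
  also have "\<dots> = (\<Sum>i<d. card S - 1)"
    using x by (intro sum.cong) (auto simp: PiE_iff)
  finally show ?thesis by simp
qed

text \<open>The \<open>k\<close> color classes partition a neighborhood into parts of equal size.\<close>

lemma neighborhood_balanced_coloring_dvd_degree:
  assumes G: "pair_graph G" and c: "neighborhood_balanced_coloring G k c" and v: "v \<in> pverts G"
  shows "k dvd card (neighbors G v)"
proof -
  interpret pair_graph G by (rule G)
  let ?N = "\<lambda>i. {w \<in> neighbors G v. c w = i}"
  have sub: "neighbors G v \<subseteq> pverts G"
    using in_arcsD2 by (auto simp: neighbors_def)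
  then have fin: "finite (neighbors G v)"
    using finite_verts by (auto intro: finite_subset)
  have "neighbors G v = (\<Union>i\<in>{1..k}. ?N i)"
    using c sub by (auto simp: neighborhood_balanced_coloring_def Pi_iff)
  then have "card (neighbors G v) = card (\<Union>i\<in>{1..k}. ?N i)"
    by simp
  also have "\<dots> = (\<Sum>i\<in>{1..k}. card (?N i))"
    using fin by (intro card_UN_disjoint) auto
  also have "\<dots> = (\<Sum>i\<in>{1..k}. card (?N 1))"
  proof (rule sum.cong[OF refl])
    fix i assume "i \<in> {1..k}"
    moreover from this have "1 \<in> {1..k}" by simp
    ultimately show "card (?N i) = card (?N 1)"
      using c v unfolding neighborhood_balanced_coloring_def by blast
  qed
  finally show ?thesis by simp
qed

text \<open>
  The coloring of a word by the sum of its first \<open>n\<close> letters modulo \<open>k\<close>, where \<open>g\<close> reads letters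
  as residues. The shift by one moves the residues into the color set \<open>{1..k}\<close>.
\<close>

definition prefix_sum_coloring :: "('a \<Rightarrow> nat) \<Rightarrow> nat \<Rightarrow> nat \<Rightarrow> (nat \<Rightarrow> 'a) \<Rightarrow> nat" where
  "prefix_sum_coloring g k n x = (\<Sum>i<n. g (x i)) mod k + 1"

text \<open>
  Changing a letter within the prefix adds the residue of the new letter to a fixed sum, and
  translation by a fixed residue permutes the residues modulo \<open>k\<close>.
\<close>

lemma bij_betw_prefix_sum_coloring_update:
  assumes g: "bij_betw g S {0..<k}" and "k > 0" and "i < n"
  shows "bij_betw (\<lambda>s. prefix_sum_coloring g k n (x(i := s))) S {1..k}"
proof -
  let ?h = "\<lambda>s. prefix_sum_coloring g k n (x(i := s))"
  let ?T = "\<Sum>j\<in>{..<n} - {i}. g (x j)"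
  have h: "?h s = (?T + g s) mod k + 1" for s
    using \<open>i < n\<close> by (simp add: prefix_sum_coloring_def sum.remove[of "{..<n}" i] add.commute)
  have "inj_on ?h S"
  proof (rule inj_onI)
    fix s t assume st: "s \<in> S" "t \<in> S" "?h s = ?h t"
    then have "[?T + g s = ?T + g t] (mod k)"
      by (simp add: h cong_def)
    then have "[g s = g t] (mod k)"
      by (simp only: cong_add_lcancel_nat)
    moreover have "g s < k" "g t < k"
      using st bij_betwE[OF g] by auto
    ultimately have "g s = g t"
      by (simp add: cong_less_modulus_unique_nat)
    then show "s = t"
      using st bij_betw_imp_inj_on[OF g] by (simp add: inj_on_eq_iff)
  qed
  moreover have "?h ` S \<subseteq> {1..k}"
    using \<open>k > 0\<close> by (auto simp: h Suc_le_eq)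
  moreover have "card S = card {1..k}"
    using bij_betw_same_card[OF g] by simp
  ultimately show ?thesis
    by (metis bij_betw_def card_image card_subset_eq finite_atLeastAtMost)
qed

lemma card_prefix_sum_coloring_update:
  assumes g: "bij_betw g S {0..<k}" and "k > 0" and "x i \<in> S" and "j \<in> {1..k}"
  shows "card {s \<in> S - {x i}. prefix_sum_coloring g k n (x(i := s)) = j}
    = (if i < n then (if j = prefix_sum_coloring g k n x then 0 else 1)
       else (if j = prefix_sum_coloring g k n x then k - 1 else 0))"
proof (cases "i < n")
  case True
  let ?h = "\<lambda>s. prefix_sum_coloring g k n (x(i := s))"
  have bij: "bij_betw ?h S {1..k}"
    by (rule bij_betw_prefix_sum_coloring_update[OF g \<open>k > 0\<close> True])
  then have inj: "inj_on ?h S"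
    by (rule bij_betw_imp_inj_on)
  have "j \<in> ?h ` S"
    unfolding bij_betw_imp_surj_on[OF bij] by (rule \<open>j \<in> {1..k}\<close>)
  then obtain s where s: "s \<in> S" "?h s = j"
    by blast
  have eq: "?h t = j \<longleftrightarrow> t = s" if "t \<in> S" for t
    using inj_on_eq_iff[OF inj that s(1)] s(2) by simp
  have own: "j = prefix_sum_coloring g k n x \<longleftrightarrow> x i = s"
    using eq[OF \<open>x i \<in> S\<close>] by auto
  have "{t \<in> S - {x i}. ?h t = j} = (if x i = s then {} else {s})"
    using eq s(1) by auto
  then show ?thesis
    using True own by simp
next
  case False
  then have "prefix_sum_coloring g k n (x(i := s)) = prefix_sum_coloring g k n x" for s
    unfolding prefix_sum_coloring_def
    by (intro arg_cong[where f = "\<lambda>t. t mod k + 1"] sum.cong) auto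
  moreover have "card (S - {x i}) = k - 1"
    using \<open>x i \<in> S\<close> bij_betw_same_card[OF g] by simp
  moreover have "{s \<in> S. s \<noteq> x i} = S - {x i}"
    by blast
  ultimately show ?thesis
    using False by simp
qed

lemma sum_if_less: "(\<Sum>i<n + m. if i < n then a else b) = n * a + m * (b::nat)"
  by (induction m) simp_all

text \<open>
  The prefix length \<open>m (k - 1)\<close> is what equates the \<open>n\<close> neighbors of each other color with
  the \<open>(d - n) (k - 1)\<close> neighbors of the own color.
\<close>

lemma neighborhood_balanced_prefix_sum_coloring:
  assumes "finite S" and g: "bij_betw g S {0..<k}" and "k > 0"
  shows "neighborhood_balanced_coloring (hamming_graph (m * k) S) k
           (prefix_sum_coloring g k (m * (k - 1)))"
proof -
  let ?n = "m * (k - 1)" and ?d = "m * k"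
  let ?c = "prefix_sum_coloring g k ?n"
  have d: "?d = ?n + m"
    using \<open>k > 0\<close> by (cases k) simp_all
  have "card {w \<in> neighbors (hamming_graph ?d S) x. ?c w = j} = ?n"
    if x: "x \<in> {..<?d} \<rightarrow>\<^sub>E S" and j: "j \<in> {1..k}" for x j
  proof -
    have "card {w \<in> neighbors (hamming_graph ?d S) x. ?c w = j}
        = (\<Sum>i<?d. card {s \<in> S - {x i}. ?c (x(i := s)) = j})"
      by (rule card_hamming_neighbors_filter[OF \<open>finite S\<close> x])
    also have "\<dots> = (\<Sum>i<?d. if i < ?n then (if j = ?c x then 0 else 1)
        else (if j = ?c x then k - 1 else 0))"
      using x j by (intro sum.cong card_prefix_sum_coloring_update[OF g \<open>k > 0\<close>]) auto
    also have "\<dots> = ?n * (if j = ?c x then 0 else 1) + m * (if j = ?c x then k - 1 else 0)"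
      unfolding d by (rule sum_if_less)
    also have "\<dots> = ?n"
      by simp
    finally show ?thesis .
  qed
  moreover have "?c x \<in> {1..k}" for x
    using \<open>k > 0\<close> by (simp add: prefix_sum_coloring_def Suc_le_eq)
  ultimately show ?thesis
    by (simp add: neighborhood_balanced_coloring_def hamming_graph_def)
qed

theorem theorem4p7:
  fixes d k :: nat and S :: "'a set"
  assumes "k \<ge> 2" and "d \<ge> 1" and "finite S" and "card S = k"
  shows "(\<exists>c. neighborhood_balanced_coloring (hamming_graph d S) k c) \<longleftrightarrow> [d = 0] (mod k)"
proof
  assume "\<exists>c. neighborhood_balanced_coloring (hamming_graph d S) k c"
  then obtain c where c: "neighborhood_balanced_coloring (hamming_graph d S) k c" ..
  have "S \<noteq> {}"
    using assms by auto
  then obtain x where x: "x \<in> {..<d} \<rightarrow>\<^sub>E S"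
    by (metis PiE_eq_empty_iff ex_in_conv)
  then have "x \<in> pverts (hamming_graph d S)"
    by (simp add: hamming_graph_def)
  then have "k dvd card (neighbors (hamming_graph d S) x)"
    by (rule neighborhood_balanced_coloring_dvd_degree[OF
          pair_graph_hamming_graph[OF \<open>finite S\<close>] c])
  then have "k dvd d * (k - 1)"
    by (simp only: card_hamming_neighbors[OF \<open>finite S\<close> x] \<open>card S = k\<close>)
  moreover have "coprime k (k - 1)"
    using assms by (intro coprime_diff_one_right_nat) simp
  ultimately have "k dvd d"
    by (simp add: coprime_dvd_mult_left_iff)
  then show "[d = 0] (mod k)"
    by (simp add: cong_0_iff)
next
  assume "[d = 0] (mod k)"
  then obtain m where m: "d = m * k"
    by (auto simp: cong_0_iff dvd_def mult.commute)
  obtain g where "bij_betw g S {0..<k}"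
    using ex_bij_betw_finite_nat[OF \<open>finite S\<close>] assms by auto
  then have "neighborhood_balanced_coloring (hamming_graph d S) k
      (prefix_sum_coloring g k (m * (k - 1)))"
    unfolding m using assms by (intro neighborhood_balanced_prefix_sum_coloring) auto
  then show "\<exists>c. neighborhood_balanced_coloring (hamming_graph d S) k c"
    by blast
qed

end
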